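(* Let $X=\{P_1,\dots,P_r\}$ be a set of $r$ distinct points of $\mathbb P^n_{\mathbf k}\setminus\{x_n=0\}$, not contained in a hyperplane, of socle degree $s$, and let $L_1,\dots,L_r$ be the associated linear forms, normalized so that the coefficient of $y_n$ in each $L_i$ is $1$. Let $I(X)^\perp$ be generated by the family $\mathcal F=\{F_t;\ t\ge1\}$ where $$F_t:=\frac1{(t+s-1)!}\sum_{i=1}^r\alpha_iL_i^{t+s-1}$$ with $\alpha_1,\dots,\alpha_r\in\mathbf k^*$. Assume that $x_n\circ F_t=F_{t-1}$ for all $t>1$ and $x_n\circ F_1=0$. Then for all $t\ge s$ $$\operatorname{Ann}_R(F_t)\circ F_{t+1}=(I(X)+(x_n))^\perp.$$
   Context: $\mathbf k$ is an algebraically closed field of characteristic zero, $n\ge1$, $R=\mathbf k[x_0,\dots,x_n]$ (standard graded) and $\Gamma=\mathbf k[y_0,\dots,y_n]$. $R$ acts on $\Gamma$ by differentiation: $f\circ g=f(\partial_{y_0},\dots,\partial_{y_n})(g)$, making $\Gamma$ an $R$-module; "generated" means generated as an $R$-module. For an ideal $I\subset R$, $I^\perp=\{G\in\Gamma: I\circ G=0\}$; for $G\in\Gamma$, $\operatorname{Ann}_R(G)=\{g\in R: g\circ G=0\}$; for an ideal $\mathfrak a$, $\mathfrak a\circ G=\{g\circ G: g\in\mathfrak a\}$. $I(X)\subset R$ is the homogeneous ideal of $X$. With $\mathrm{HF}_X(t)=\dim_{\mathbf k}(R/I(X))_t$, the socle degree $s$ of $X$ is the largest $t$ with $\mathrm{HF}_X(t)-\mathrm{HF}_X(t-1)\ne0$,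 equivalently the least $t$ with $\mathrm{HF}_X(t)=r$. The linear form associated to $P=[a_0,\dots,a_n]$ is $L=a_0y_0+\cdots+a_ny_n\in\Gamma$; for points off $\{x_n=0\}$ the representatives are chosen with $a_n=1$. *)

theory Defs
  imports
    "HOL-Library.Poly_Mapping"
    "HOL-Computational_Algebra.Polynomial"
    "HOL-Algebra.Module"
    "HOL-Algebra.QuotRing"
    "HOL-Algebra.Embedded_Algebras"
begin

section \<open>Polynomials in finitely many variables\<close>

text \<open>An element of \<open>'k mpol\<close> maps exponent vectors to coefficients. The polynomial rings
  \<open>R\<close> and \<open>\<Gamma>\<close> in \<open>n + 1\<close> variables are both carried by \<open>polys n\<close>, the polynomials
  that involve only the variables with index at most \<open>n\<close>.\<close>

type_synonym 'k mpol = "(nat \<Rightarrow>\<^sub>0 nat) \<Rightarrow>\<^sub>0 'k"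

definition pconst :: "'k::zero \<Rightarrow> 'k mpol" where
  "pconst c = Poly_Mapping.single 0 c"

definition pvar :: "nat \<Rightarrow> 'k::zero_neq_one mpol" where
  "pvar i = Poly_Mapping.single (Poly_Mapping.single i 1) 1"

definition mdeg :: "(nat \<Rightarrow>\<^sub>0 nat) \<Rightarrow> nat" where
  "mdeg m = (\<Sum>i\<in>Poly_Mapping.keys m. Poly_Mapping.lookup m i)"

definition peval :: "'k::comm_semiring_1 mpol \<Rightarrow> (nat \<Rightarrow> 'k) \<Rightarrow> 'k" where
  "peval f v = (\<Sum>m\<in>Poly_Mapping.keys f.
     Poly_Mapping.lookup f m * (\<Prod>i\<in>Poly_Mapping.keys m. v i ^ Poly_Mapping.lookup m i))"

definition polys :: "nat \<Rightarrow> 'k::zero mpol set" where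
  "polys n = {p. \<forall>m\<in>Poly_Mapping.keys p. Poly_Mapping.keys m \<subseteq> {..n}}"

definition forms :: "nat \<Rightarrow> nat \<Rightarrow> 'k::zero mpol set" where
  "forms n d = {p \<in> polys n. \<forall>m\<in>Poly_Mapping.keys p. mdeg m = d}"

definition polyR :: "nat \<Rightarrow> 'k::comm_ring_1 mpol ring" where
  "polyR n = \<lparr>carrier = polys n, mult = (*), one = 1, zero = 0, add = (+)\<rparr>"


section \<open>The action by differentiation\<close>

definition pdiff :: "nat \<Rightarrow> 'k::comm_semiring_1 mpol \<Rightarrow> 'k mpol" where
  "pdiff i g = (\<Sum>m\<in>Poly_Mapping.keys g.
     Poly_Mapping.single (m - Poly_Mapping.single i 1)
       (of_nat (Poly_Mapping.lookup m i) * Poly_Mapping.lookup g m))"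

text \<open>The iterated partial derivative with multi-index \<open>a\<close>.\<close>

definition pdiffs :: "(nat \<Rightarrow>\<^sub>0 nat) \<Rightarrow> 'k::comm_semiring_1 mpol \<Rightarrow> 'k mpol" where
  "pdiffs a = foldr (\<lambda>i h. (pdiff i ^^ Poly_Mapping.lookup a i) \<circ> h)
     (sorted_list_of_set (Poly_Mapping.keys a)) id"

definition diff_act :: "'k::comm_semiring_1 mpol \<Rightarrow> 'k mpol \<Rightarrow> 'k mpol" (infixr \<open>\<circ>\<^sub>d\<close> 75) where
  "f \<circ>\<^sub>d g = (\<Sum>a\<in>Poly_Mapping.keys f. pconst (Poly_Mapping.lookup f a) * pdiffs a g)"

definition polyGamma :: "nat \<Rightarrow> ('k::comm_ring_1 mpol, 'k mpol) module" where
  "polyGamma n = \<lparr>carrier = polys n, mult = (*), one = 1, zero = 0, add = (+), smult = diff_act\<rparr>"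

definition generated_submodule :: "nat \<Rightarrow> 'k::comm_ring_1 mpol set \<Rightarrow> 'k mpol set" where
  "generated_submodule n S = \<Inter>{N. submodule N (polyR n) (polyGamma n) \<and> S \<subseteq> N}"

definition perp :: "nat \<Rightarrow> 'k::comm_ring_1 mpol set \<Rightarrow> 'k mpol set" where
  "perp n I = {G \<in> polys n. \<forall>f\<in>I. f \<circ>\<^sub>d G = 0}"

definition Ann :: "nat \<Rightarrow> 'k::comm_ring_1 mpol \<Rightarrow> 'k mpol set" where
  "Ann n G = {g \<in> polys n. g \<circ>\<^sub>d G = 0}"

definition act_set :: "'k::comm_ring_1 mpol set \<Rightarrow> 'k mpol \<Rightarrow> 'k mpol set" where
  "act_set A G = (\<lambda>g. g \<circ>\<^sub>d G) ` A"


section \<open>Points of projective space\<close>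

text \<open>Vectors of length \<open>n + 1\<close> are functions on the naturals that vanish above \<open>n\<close>;
  a point of projective space is the set of all its homogeneous coordinate vectors.\<close>

definition hvecs :: "nat \<Rightarrow> (nat \<Rightarrow> 'k::field) set" where
  "hvecs n = {v. (\<forall>j>n. v j = 0) \<and> (\<exists>j\<le>n. v j \<noteq> 0)}"

definition proj_rel :: "nat \<Rightarrow> ((nat \<Rightarrow> 'k::field) \<times> (nat \<Rightarrow> 'k)) set" where
  "proj_rel n = {(u, v). u \<in> hvecs n \<and> v \<in> hvecs n \<and> (\<exists>c. c \<noteq> 0 \<and> v = (\<lambda>j. c * u j))}"

definition proj_space :: "nat \<Rightarrow> (nat \<Rightarrow> 'k::field) set set" where
  "proj_space n = hvecs n // proj_rel n"

definition proj_zeros :: "nat \<Rightarrow> 'k::field mpol \<Rightarrow> (nat \<Rightarrow> 'k) set set" where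
  "proj_zeros n f = {p \<in> proj_space n. \<forall>v\<in>p. peval f v = 0}"

definition in_hyperplane :: "nat \<Rightarrow> (nat \<Rightarrow> 'k::field) set set \<Rightarrow> bool" where
  "in_hyperplane n X \<longleftrightarrow> (\<exists>l\<in>forms n 1. l \<noteq> 0 \<and> X \<subseteq> proj_zeros n l)"

definition vanishing_ideal :: "nat \<Rightarrow> (nat \<Rightarrow> 'k::field) set set \<Rightarrow> 'k mpol set" where
  "vanishing_ideal n X = Idl\<^bsub>polyR n\<^esub> {f. (\<exists>d. f \<in> forms n d) \<and> X \<subseteq> proj_zeros n f}"

definition linear_form :: "nat \<Rightarrow> (nat \<Rightarrow> 'k::comm_semiring_1) \<Rightarrow> 'k mpol" where
  "linear_form n a = (\<Sum>j\<le>n. pconst (a j) * pvar j)"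


section \<open>Hilbert function and socle degree\<close>

text \<open>The dimension of the degree \<open>t\<close> part of \<open>R / I(X)\<close> over the image of the constants
  in \<open>R / I(X)\<close>, which is a copy of the ground field when \<open>X\<close> is nonempty.\<close>

definition hilbert_fun :: "nat \<Rightarrow> (nat \<Rightarrow> 'k::field) set set \<Rightarrow> nat \<Rightarrow> nat" where
  "hilbert_fun n X t =
    (let R = polyR n; I = vanishing_ideal n X
     in ring.dim (R Quot I) (range (\<lambda>c. I +>\<^bsub>R\<^esub> pconst c)) ((\<lambda>f. I +>\<^bsub>R\<^esub> f) ` forms n t))"

definition hilbert_diff :: "nat \<Rightarrow> (nat \<Rightarrow> 'k::field) set set \<Rightarrow> nat \<Rightarrow> int" where
  "hilbert_diff n X t =
    int (hilbert_fun n X t) - (if t = 0 then 0 else int (hilbert_fun n X (t - 1)))"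

definition has_socle_degree :: "nat \<Rightarrow> (nat \<Rightarrow> 'k::field) set set \<Rightarrow> nat \<Rightarrow> bool" where
  "has_socle_degree n X s \<longleftrightarrow> hilbert_diff n X s \<noteq> 0 \<and> (\<forall>t>s. hilbert_diff n X t = 0)"

end

theory Submission
  imports Defs
begin

text \<open>Write \<open>L\<^sup>[\<^sup>d\<^sup>]\<close> for the divided power \<open>L\<^sup>d / d!\<close>. A form \<open>g\<close> of degree \<open>e\<close> acts by
  \<open>g \<circ> L\<^sub>i\<^sup>[\<^sup>d\<^sup>] = g(a\<^sub>i) L\<^sub>i\<^sup>[\<^sup>d\<^sup>-\<^sup>e\<^sup>]\<close>, so the module generated by the \<open>F\<^sub>t\<close> consists of combinations of
  the \<open>L\<^sub>i\<^sup>[\<^sup>d\<^sup>]\<close>. Since \<open>x\<^sub>n\<close> is a nonzerodivisor modulo \<open>I(X)\<close> and the Hilbert function is constant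
  from \<open>s\<close> on, multiplication by \<open>x\<^sub>n\<close> is bijective there; as forms of large degree interpolate
  arbitrary values on \<open>X\<close>, forms of every degree at least \<open>s\<close> do.
  Pairing with interpolating forms shows that an element of \<open>I(X)\<^sup>\<bottom>\<close> killed by \<open>x\<^sub>n\<close> involves
  only \<open>L\<^sub>i\<^sup>[\<^sup>d\<^sup>]\<close> with \<open>d \<le> s\<close>, and for \<open>t \<ge> s\<close> interpolation in degree \<open>t + s - d \<ge> s\<close> writes it as
  \<open>g \<circ> F\<^sub>t\<^sub>+\<^sub>1\<close>; then \<open>g \<circ> F\<^sub>t = x\<^sub>n \<circ> (g \<circ> F\<^sub>t\<^sub>+\<^sub>1) = 0\<close>.\<close>

section \<open>Induction principles for polynomials and exponent vectors\<close>

lemma update_eq_single_add: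
  fixes f :: "'a \<Rightarrow>\<^sub>0 'b::monoid_add"
  assumes "k \<notin> Poly_Mapping.keys f"
  shows "Poly_Mapping.update k c f = Poly_Mapping.single k c + f"
  using assms
  by (intro poly_mapping_eqI)
    (auto simp: lookup_update lookup_add lookup_single when_def not_in_keys_iff_lookup_eq_zero)

text \<open>Inserting a fresh key is the same as adding a one-term map. Any property compatible with
  sums thus reduces to monomials; the multiplicativity of evaluation, the Leibniz rule and the
  module law are proved this way.\<close>

lemma poly_mapping_sum_induct [case_names zero single add]:
  fixes p :: "'a \<Rightarrow>\<^sub>0 'b::monoid_add"
  assumes "P 0" "\<And>m c. P (Poly_Mapping.single m c)" "\<And>p q. P p \<Longrightarrow> P q \<Longrightarrow> P (p + q)"
  shows "P p"
proof (induction p rule: update_induct)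
  case (update f k c)
  then show ?case using assms by (simp add: update_eq_single_add)
qed (rule assms)

text \<open>Every exponent vector is a sum of unit vectors. This peels iterated derivatives one
  variable at a time.\<close>

lemma exponent_induct [case_names zero add]:
  fixes m :: "'a \<Rightarrow>\<^sub>0 nat"
  assumes "P 0" "\<And>i m. P m \<Longrightarrow> P (Poly_Mapping.single i 1 + m)"
  shows "P m"
proof -
  have single: "P (Poly_Mapping.single i k + m)" if "P m" for i k m
  proof (induction k)
    case (Suc k)
    have "Poly_Mapping.single i (Suc k) = Poly_Mapping.single i 1 + Poly_Mapping.single i k"
      by (metis plus_1_eq_Suc single_add)
    then show ?case using assms(2)[OF Suc] by (simp add: add.assoc)
  qed (use that in simp)
  show ?thesis
  proof (induction m rule: update_induct)
    case (update f k c)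
    then show ?case using single by (simp add: update_eq_single_add)
  qed (rule assms)
qed

lemma keys_exponent_add:
  fixes k l :: "'a \<Rightarrow>\<^sub>0 nat"
  shows "Poly_Mapping.keys (k + l) = Poly_Mapping.keys k \<union> Poly_Mapping.keys l"
  by (auto simp: in_keys_iff lookup_add)

lemma mdeg_eq_sum:
  assumes "finite A" "Poly_Mapping.keys m \<subseteq> A"
  shows "mdeg m = (\<Sum>i\<in>A. Poly_Mapping.lookup m i)"
  unfolding mdeg_def using assms
  by (intro sum.mono_neutral_left) (auto simp: in_keys_iff)

lemma mdeg_0 [simp]: "mdeg 0 = 0"
  by (simp add: mdeg_def)

lemma mdeg_add: "mdeg (k + l) = mdeg k + mdeg l"
proof -
  let ?A = "Poly_Mapping.keys k \<union> Poly_Mapping.keys l"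
  have "mdeg (k + l) = (\<Sum>i\<in>?A. Poly_Mapping.lookup (k + l) i)"
    by (rule mdeg_eq_sum) (auto simp: keys_exponent_add)
  also have "\<dots> = mdeg k + mdeg l"
    by (simp add: lookup_add sum.distrib mdeg_eq_sum[of ?A])
  finally show ?thesis .
qed

lemma mdeg_single [simp]: "mdeg (Poly_Mapping.single i k) = k"
  by (simp add: mdeg_def)

lemma pconst_0 [simp]: "pconst 0 = 0"
  by (simp add: pconst_def)

lemma pconst_1 [simp]: "pconst 1 = 1"
  by (simp add: pconst_def)

lemma pconst_add: "pconst (c + d) = pconst c + pconst d"
  by (simp add: pconst_def single_add)

lemma pconst_mult: "pconst (c * d) = pconst c * (pconst d :: 'k::comm_semiring_1 mpol)"
  by (simp add: pconst_def mult_single)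

lemma pconst_uminus: "pconst (- c) = - (pconst c :: 'k::comm_ring_1 mpol)"
  by (simp add: pconst_def single_uminus)

lemma pconst_of_nat: "pconst (of_nat k) = (of_nat k :: 'k::comm_semiring_1 mpol)"
  by (simp add: pconst_def)

lemma lookup_pconst_mult:
  "Poly_Mapping.lookup (pconst c * p) m = c * Poly_Mapping.lookup (p :: 'k::comm_semiring_1 mpol) m"
proof (induction p rule: poly_mapping_sum_induct)
  case (single k d)
  then show ?case by (simp add: pconst_def mult_single lookup_single when_def)
qed (auto simp: lookup_add algebra_simps)


section \<open>Evaluation\<close>

definition monom_val :: "(nat \<Rightarrow>\<^sub>0 nat) \<Rightarrow> (nat \<Rightarrow> 'k::comm_semiring_1) \<Rightarrow> 'k" where
  "monom_val m v = (\<Prod>i\<in>Poly_Mapping.keys m. v i ^ Poly_Mapping.lookup m i)"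

lemma monom_val_eq_prod:
  assumes "finite A" "Poly_Mapping.keys m \<subseteq> A"
  shows "monom_val m v = (\<Prod>i\<in>A. v i ^ Poly_Mapping.lookup m i)"
  unfolding monom_val_def using assms
  by (intro prod.mono_neutral_left) (auto simp: in_keys_iff)

lemma monom_val_0 [simp]: "monom_val 0 v = 1"
  by (simp add: monom_val_def)

lemma monom_val_single [simp]: "monom_val (Poly_Mapping.single i k) v = v i ^ k"
  by (simp add: monom_val_def)

lemma monom_val_add: "monom_val (k + l) v = monom_val k v * monom_val l v"
proof -
  let ?A = "Poly_Mapping.keys k \<union> Poly_Mapping.keys l"
  have "monom_val (k + l) v = (\<Prod>i\<in>?A. v i ^ Poly_Mapping.lookup (k + l) i)"
    by (rule monom_val_eq_prod) (auto simp: keys_exponent_add)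
  also have "\<dots> = monom_val k v * monom_val l v"
    by (simp add: lookup_add power_add prod.distrib monom_val_eq_prod[of ?A])
  finally show ?thesis .
qed

lemma monom_val_scale: "monom_val m (\<lambda>j. c * v j) = c ^ mdeg m * monom_val m v"
  by (simp add: monom_val_def mdeg_def power_mult_distrib prod.distrib power_sum)

lemma peval_monom_val:
  "peval f v = (\<Sum>m\<in>Poly_Mapping.keys f. Poly_Mapping.lookup f m * monom_val m v)"
  by (simp add: peval_def monom_val_def)

lemma peval_0 [simp]: "peval 0 v = 0"
  by (simp add: peval_def)

lemma peval_single [simp]: "peval (Poly_Mapping.single m c) v = c * monom_val m v"
  by (simp add: peval_monom_val)

lemma peval_add: "peval (f + g) v = peval f v + peval g v"
  unfolding peval_monom_val
  by (rule setsum_keys_plus_distrib) (auto simp: algebra_simps)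

lemma peval_mult: "peval (f * g) v = peval f v * peval g v"
proof (induction f rule: poly_mapping_sum_induct)
  case (single m c)
  show ?case
  proof (induction g rule: poly_mapping_sum_induct)
    case (single k d)
    show ?case by (simp add: mult_single monom_val_add algebra_simps)
  qed (auto simp: peval_add algebra_simps)
qed (auto simp: peval_add algebra_simps)

lemma peval_pconst [simp]: "peval (pconst c) v = c"
  by (simp add: pconst_def)

lemma peval_1 [simp]: "peval 1 v = 1"
  using peval_pconst[of 1] by simp

lemma peval_pvar [simp]: "peval (pvar i) v = v i"
  by (simp add: pvar_def)

lemma peval_power: "peval (f ^ k) v = peval f v ^ k"
  by (induction k) (auto simp: peval_mult)

lemma peval_prod: "peval (\<Prod>i\<in>A. f i) v = (\<Prod>i\<in>A. peval (f i) v)"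
  by (induction A rule: infinite_finite_induct) (auto simp: peval_mult)

lemma peval_uminus: "peval (- f) v = - peval f (v :: nat \<Rightarrow> 'k::comm_ring_1)"
  by (metis add.right_inverse minus_unique peval_0 peval_add)

lemma peval_diff: "peval (f - g) v = peval f v - peval g (v :: nat \<Rightarrow> 'k::comm_ring_1)"
  by (metis ab_group_add_class.ab_diff_conv_add_uminus peval_add peval_uminus)

text \<open>All monomials share the degree \<open>d\<close>, so the factor \<open>c ^ d\<close>
  comes out. Whether a form vanishes therefore depends only on the projective point.\<close>

lemma peval_scale:
  assumes "f \<in> forms n d"
  shows "peval f (\<lambda>j. c * v j) = c ^ d * peval f v"
  using assms
  by (auto simp: peval_monom_val forms_def monom_val_scale sum_distrib_left mult_ac intro!: sum.cong)


section \<open>Polynomials and forms\<close>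

lemma polys_0 [simp]: "0 \<in> polys n"
  by (simp add: polys_def)

lemma polys_pconst [simp]: "pconst c \<in> polys n"
  by (simp add: polys_def pconst_def)

lemma polys_1 [simp]: "1 \<in> polys n"
  by (metis pconst_1 polys_pconst)

lemma polys_add: "f \<in> polys n \<Longrightarrow> g \<in> polys n \<Longrightarrow> f + g \<in> polys n"
  using keys_add[of f g] by (fastforce simp: polys_def)

lemma polys_mult:
  "f \<in> polys n \<Longrightarrow> g \<in> polys n \<Longrightarrow> f * g \<in> (polys n :: 'k::comm_semiring_1 mpol set)"
  using keys_mult[of f g] unfolding polys_def
  by (fastforce simp: keys_exponent_add)

lemma polys_uminus: "f \<in> polys n \<Longrightarrow> - f \<in> (polys n :: 'k::comm_ring_1 mpol set)"
  by (simp add: polys_def in_keys_iff)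

lemma polys_sum: "(\<And>i. i \<in> A \<Longrightarrow> f i \<in> polys n) \<Longrightarrow> sum f A \<in> polys n"
  by (induction A rule: infinite_finite_induct) (auto simp: polys_add)

lemma polys_power: "f \<in> polys n \<Longrightarrow> f ^ k \<in> (polys n :: 'k::comm_semiring_1 mpol set)"
  by (induction k) (auto simp: polys_mult)

lemma polys_pvar: "i \<le> n \<Longrightarrow> pvar i \<in> polys n"
  by (simp add: polys_def pvar_def)

lemma forms_imp_polys: "f \<in> forms n d \<Longrightarrow> f \<in> polys n"
  by (simp add: forms_def)

lemma forms_0 [simp]: "0 \<in> forms n d"
  by (simp add: forms_def)

lemma forms_add: "f \<in> forms n d \<Longrightarrow> g \<in> forms n d \<Longrightarrow> f + g \<in> forms n d"
  using keys_add[of f g] by (fastforce simp: forms_def polys_add)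

lemma forms_mult:
  "f \<in> forms n d \<Longrightarrow> g \<in> forms n e \<Longrightarrow> f * g \<in> (forms n (d + e) :: 'k::comm_semiring_1 mpol set)"
  using keys_mult[of f g] unfolding forms_def
  by (fastforce simp: mdeg_add polys_mult)

lemma forms_uminus: "f \<in> forms n d \<Longrightarrow> - f \<in> (forms n d :: 'k::comm_ring_1 mpol set)"
  by (simp add: forms_def polys_uminus in_keys_iff)

lemma forms_diff:
  "f \<in> forms n d \<Longrightarrow> g \<in> forms n d \<Longrightarrow> f - g \<in> (forms n d :: 'k::comm_ring_1 mpol set)"
  by (metis ab_group_add_class.ab_diff_conv_add_uminus forms_add forms_uminus)

lemma forms_sum: "(\<And>i. i \<in> A \<Longrightarrow> f i \<in> forms n d) \<Longrightarrow> sum f A \<in> forms n d"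
  by (induction A rule: infinite_finite_induct) (auto simp: forms_add)

lemma forms_pconst: "pconst c \<in> forms n 0"
  by (simp add: forms_def) (simp add: pconst_def)

lemma forms_1: "1 \<in> forms n 0"
  by (metis forms_pconst pconst_1)

lemma forms_pconst_mult:
  "f \<in> forms n d \<Longrightarrow> pconst c * f \<in> (forms n d :: 'k::comm_semiring_1 mpol set)"
  using forms_mult[OF forms_pconst] by fastforce

lemma forms_pvar: "i \<le> n \<Longrightarrow> pvar i \<in> forms n 1"
  by (simp add: forms_def polys_pvar) (simp add: pvar_def)

lemma forms_power:
  "f \<in> forms n d \<Longrightarrow> f ^ k \<in> (forms n (d * k) :: 'k::comm_semiring_1 mpol set)"
  by (induction k) (auto simp: forms_1 forms_mult)

lemma forms_prod:
  assumes "finite A" "\<And>i. i \<in> A \<Longrightarrow> f i \<in> (forms n 1 :: 'k::comm_semiring_1 mpol set)"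
  shows "prod f A \<in> forms n (card A)"
  using assms by (induction A rule: finite_induct) (use forms_1 forms_mult in fastforce)+

lemma cring_polyR: "cring (polyR n :: 'k::comm_ring_1 mpol ring)"
proof (rule cringI)
  show "abelian_group (polyR n :: 'k mpol ring)"
  proof (rule abelian_groupI)
    fix x :: "'k mpol" assume "x \<in> carrier (polyR n)"
    then show "\<exists>y\<in>carrier (polyR n). y \<oplus>\<^bsub>polyR n\<^esub> x = \<zero>\<^bsub>polyR n\<^esub>"
      by (intro bexI[of _ "- x"]) (auto simp: polyR_def polys_uminus)
  qed (auto simp: polyR_def polys_add ac_simps)
  show "comm_monoid (polyR n :: 'k mpol ring)"
    by (rule comm_monoidI) (auto simp: polyR_def polys_mult ac_simps)
qed (auto simp: polyR_def algebra_simps)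


section \<open>The differential action\<close>

lemma pdiff_0 [simp]: "pdiff i 0 = 0"
  by (simp add: pdiff_def)

lemma pdiff_single:
  "pdiff i (Poly_Mapping.single m c) =
     Poly_Mapping.single (m - Poly_Mapping.single i 1) (of_nat (Poly_Mapping.lookup m i) * c)"
  by (simp add: pdiff_def)

lemma pdiff_add: "pdiff i (f + g) = pdiff i f + pdiff i g"
  unfolding pdiff_def
  by (rule setsum_keys_plus_distrib) (auto simp: algebra_simps single_add)

lemma pdiff_mult: "pdiff i (f * g) = pdiff i f * g + f * pdiff i g"
proof (induction f rule: poly_mapping_sum_induct)
  case (single m c)
  show ?case
  proof (induction g rule: poly_mapping_sum_induct)
    case (single k d)
    let ?e = "Poly_Mapping.single i (1::nat)"
    \<comment> \<open>Subtraction of exponents is truncated, so the two exponents can differ only if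
      variable \<open>i\<close> is absent from \<open>a\<close>; the coefficient is 0 in that
      case.\<close>
    have *: "Poly_Mapping.single (a - ?e + b) (of_nat (Poly_Mapping.lookup a i) * x) =
      Poly_Mapping.single (a + b - ?e) (of_nat (Poly_Mapping.lookup a i) * x)" for a b and x :: 'a
    proof (cases "Poly_Mapping.lookup a i = 0")
      case False
      then have "a - ?e + b = a + b - ?e"
        by (intro poly_mapping_eqI) (auto simp: lookup_add lookup_minus lookup_single when_def)
      then show ?thesis by simp
    qed simp
    show ?case
      using *[of m k "c * d"] *[of k m "c * d"]
      by (simp add: pdiff_single mult_single lookup_add algebra_simps flip: single_add)
  qed (auto simp: pdiff_add algebra_simps)
qed (auto simp: pdiff_add algebra_simps)

lemma pdiff_pconst [simp]: "pdiff i (pconst c) = 0"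
  by (simp add: pconst_def pdiff_single)

lemma pdiff_pconst_mult: "pdiff i (pconst c * f) = pconst c * pdiff i f"
  by (simp add: pdiff_mult)

lemma pdiff_sum: "pdiff i (sum f A) = (\<Sum>x\<in>A. pdiff i (f x))"
  by (induction A rule: infinite_finite_induct) (auto simp: pdiff_add)

lemma pdiff_commute: "pdiff i (pdiff j f) = pdiff j (pdiff i f)"
proof (induction f rule: poly_mapping_sum_induct)
  case (single m c)
  show ?case
    by (cases "i = j")
      (auto simp: pdiff_single lookup_minus lookup_single when_def diff_diff_add algebra_simps)
qed (auto simp: pdiff_add)

text \<open>Indices with exponent 0 contribute the identity. The vectors \<open>k\<close>,
  \<open>l\<close> and \<open>k + l\<close>, whose key sets differ, can thus be folded over one
  common list.\<close>

lemma pdiffs_superset: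
  assumes "distinct xs" "sorted xs" "Poly_Mapping.keys m \<subseteq> set xs"
  shows "pdiffs m = foldr (\<lambda>i h. (pdiff i ^^ Poly_Mapping.lookup m i) \<circ> h) xs id"
proof -
  have "sorted_list_of_set (Poly_Mapping.keys m) = filter (\<lambda>i. i \<in> Poly_Mapping.keys m) xs"
    using assms by (intro sorted_distinct_set_unique) (auto simp: sorted_wrt_filter)
  moreover have "foldr (\<lambda>i h. (pdiff i ^^ Poly_Mapping.lookup m i) \<circ> h)
      (filter (\<lambda>i. i \<in> Poly_Mapping.keys m) xs) id =
    foldr (\<lambda>i h. (pdiff i ^^ Poly_Mapping.lookup m i) \<circ> h) xs id"
    by (induction xs) (auto simp: in_keys_iff)
  ultimately show ?thesis by (simp add: pdiffs_def)
qed

lemma funpow_commute_fun: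
  assumes "\<And>x. f (g x) = g (f x)"
  shows "(f ^^ k) (g x) = g ((f ^^ k) x)"
  using assms by (induction k) auto

text \<open>The operators commute, so each power of \<open>T y\<close> from the second fold can be
  moved past the whole first fold and merged with the matching power there.\<close>

lemma foldr_funpow_add:
  fixes T :: "'i \<Rightarrow> 'a \<Rightarrow> 'a"
  assumes comm: "\<And>i j x. T i (T j x) = T j (T i x)"
  shows "foldr (\<lambda>i h. (T i ^^ (k i + l i)) \<circ> h) xs id x =
    foldr (\<lambda>i h. (T i ^^ k i) \<circ> h) xs id (foldr (\<lambda>i h. (T i ^^ l i) \<circ> h) xs id x)"
proof (induction xs)
  case (Cons y ys)
  have 1: "(T i ^^ p) ((T j ^^ q) z) = (T j ^^ q) ((T i ^^ p) z)" for i j p q z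
    by (intro funpow_commute_fun) (metis funpow_commute_fun comm)
  have 2: "foldr (\<lambda>i h. (T i ^^ k i) \<circ> h) zs id ((T y ^^ q) z) =
    (T y ^^ q) (foldr (\<lambda>i h. (T i ^^ k i) \<circ> h) zs id z)" for zs q z
    by (induction zs) (auto simp: 1)
  let ?f = "\<lambda>k. foldr (\<lambda>i h. (T i ^^ k i) \<circ> h)"
  have "?f (\<lambda>i. k i + l i) (y # ys) id x = (T y ^^ k y) ((T y ^^ l y) (?f (\<lambda>i. k i + l i) ys id x))"
    by (simp add: funpow_add)
  also have "\<dots> = (T y ^^ k y) ((T y ^^ l y) (?f k ys id (?f l ys id x)))"
    by (simp only: Cons)
  also have "\<dots> = (T y ^^ k y) (?f k ys id ((T y ^^ l y) (?f l ys id x)))"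
    by (simp only: 2)
  also have "\<dots> = ?f k (y # ys) id (?f l (y # ys) id x)"
    by simp
  finally show ?case .
qed simp

lemma pdiffs_add_exponent: "pdiffs (k + l) f = pdiffs k (pdiffs l f)"
proof -
  let ?xs = "sorted_list_of_set (Poly_Mapping.keys k \<union> Poly_Mapping.keys l)"
  have *: "pdiffs m = foldr (\<lambda>i h. (pdiff i ^^ Poly_Mapping.lookup m i) \<circ> h) ?xs id"
    if "m \<in> {k, l, k + l}" for m
    by (rule pdiffs_superset) (use that in \<open>auto simp: keys_exponent_add\<close>)
  have "pdiffs (k + l) f = foldr (\<lambda>i h. (pdiff i ^^ (Poly_Mapping.lookup k i + Poly_Mapping.lookup l i)) \<circ> h) ?xs id f"
    by (simp add: * lookup_add)
  also have "\<dots> = pdiffs k (pdiffs l f)"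
    by (subst foldr_funpow_add[of pdiff, OF pdiff_commute]) (simp add: *)
  finally show ?thesis .
qed

lemma pdiffs_0 [simp]: "pdiffs 0 f = f"
  by (simp add: pdiffs_def)

lemma pdiffs_single [simp]: "pdiffs (Poly_Mapping.single i 1) f = pdiff i f"
  by (simp add: pdiffs_def)

lemma pdiffs_zero [simp]: "pdiffs m 0 = 0"
  by (induction m rule: exponent_induct) (simp_all only: pdiffs_0 pdiffs_add_exponent pdiffs_single pdiff_0)

lemma pdiffs_add: "pdiffs m (f + g) = pdiffs m f + pdiffs m g"
  by (induction m rule: exponent_induct)
    (simp_all only: pdiffs_0 pdiffs_add_exponent pdiffs_single pdiff_add)

lemma pdiffs_pconst_mult: "pdiffs m (pconst c * f) = pconst c * pdiffs m f"
  by (induction m rule: exponent_induct)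
    (simp_all only: pdiffs_0 pdiffs_add_exponent pdiffs_single pdiff_pconst_mult)

lemma diff_act_0_left [simp]: "0 \<circ>\<^sub>d g = 0"
  by (simp add: diff_act_def)

lemma diff_act_0_right [simp]: "f \<circ>\<^sub>d 0 = 0"
  by (simp add: diff_act_def)

lemma diff_act_single: "Poly_Mapping.single m c \<circ>\<^sub>d g = pconst c * pdiffs m g"
  by (simp add: diff_act_def)

lemma diff_act_add_left: "(f + f') \<circ>\<^sub>d g = f \<circ>\<^sub>d g + f' \<circ>\<^sub>d g"
  unfolding diff_act_def
  by (rule setsum_keys_plus_distrib) (auto simp: algebra_simps pconst_add)

lemma diff_act_add_right: "f \<circ>\<^sub>d (g + g') = f \<circ>\<^sub>d g + f \<circ>\<^sub>d g'"
  by (simp add: diff_act_def pdiffs_add algebra_simps sum.distrib)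

lemma diff_act_pconst_right: "f \<circ>\<^sub>d (pconst c * g) = pconst c * (f \<circ>\<^sub>d g)"
  by (simp add: diff_act_def pdiffs_pconst_mult sum_distrib_left mult.left_commute)

lemma diff_act_sum_left: "(\<Sum>x\<in>A. f x) \<circ>\<^sub>d g = (\<Sum>x\<in>A. f x \<circ>\<^sub>d g)"
  by (induction A rule: infinite_finite_induct) (auto simp: diff_act_add_left)

lemma diff_act_sum_right: "f \<circ>\<^sub>d (\<Sum>x\<in>A. g x) = (\<Sum>x\<in>A. f \<circ>\<^sub>d g x)"
  by (induction A rule: infinite_finite_induct) (auto simp: diff_act_add_right)

text \<open>Both sides are additive in \<open>f\<close> and \<open>g\<close>, and on monomials the
  claim is \<open>pdiffs_add_exponent\<close>. Since polynomials commute, so do any two of these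
  operators.\<close>

lemma diff_act_mult: "(f * g) \<circ>\<^sub>d h = f \<circ>\<^sub>d (g \<circ>\<^sub>d h)"
proof (induction f rule: poly_mapping_sum_induct)
  case (single m c)
  show ?case
  proof (induction g rule: poly_mapping_sum_induct)
    case (single k d)
    show ?case
      by (simp add: mult_single diff_act_single pdiffs_add_exponent pdiffs_pconst_mult pconst_mult mult.assoc)
  qed (auto simp: algebra_simps diff_act_add_left diff_act_add_right)
qed (auto simp: algebra_simps diff_act_add_left diff_act_add_right)

lemma diff_act_commute: "f \<circ>\<^sub>d (g \<circ>\<^sub>d h) = g \<circ>\<^sub>d (f \<circ>\<^sub>d h)"
  by (metis diff_act_mult mult.commute)


section \<open>Divided powers of linear forms\<close>

text \<open>The divided power: the factorial absorbs the numerical factor created by each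
  differentiation, and \<open>F t\<close> becomes a combination with coefficients exactly
  \<open>\<alpha> i\<close>.\<close>

definition dpow :: "nat \<Rightarrow> (nat \<Rightarrow> 'k::field_char_0) \<Rightarrow> nat \<Rightarrow> 'k mpol" where
  "dpow n v d = pconst (1 / fact d) * linear_form n v ^ d"

lemma pdiff_linear_form:
  assumes "j \<le> n"
  shows "pdiff j (linear_form n v) = pconst (v j)"
proof -
  have "pdiff j (pvar i) = (if i = j then 1 else 0 :: 'a mpol)" for i
    by (auto simp: pvar_def pdiff_single lookup_single)
  then have "pdiff j (linear_form n v) = (\<Sum>i\<le>n. if i = j then pconst (v i) else 0)"
    unfolding linear_form_def pdiff_sum pdiff_pconst_mult by (intro sum.cong) auto
  then show ?thesis using assms by simp
qed

lemma linear_form_in_polys: "linear_form n v \<in> polys n"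
  by (auto simp: linear_form_def intro!: polys_sum polys_mult polys_pvar)

lemma dpow_in_polys: "dpow n v d \<in> polys n"
  by (auto simp: dpow_def intro!: polys_mult polys_power linear_form_in_polys)

lemma dpow_0 [simp]: "dpow n v 0 = 1"
  by (simp add: dpow_def)

lemma pdiff_1 [simp]: "pdiff i 1 = 0"
  by (metis pconst_1 pdiff_pconst)

lemma pdiff_power: "pdiff i (f ^ Suc d) = of_nat (Suc d) * f ^ d * pdiff i f"
  by (induction d) (simp_all add: pdiff_mult algebra_simps)

lemma pdiff_dpow_Suc:
  assumes "j \<le> n"
  shows "pdiff j (dpow n v (Suc d)) = pconst (v j) * dpow n v d"
proof -
  have "pdiff j (dpow n v (Suc d)) =
    pconst (1 / fact (Suc d)) * (pconst (of_nat (Suc d)) * linear_form n v ^ d * pconst (v j))"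
    using assms by (simp only: dpow_def pdiff_pconst_mult pdiff_power pdiff_linear_form pconst_of_nat)
  also have "\<dots> = pconst (1 / fact (Suc d) * of_nat (Suc d)) * linear_form n v ^ d * pconst (v j)"
    by (simp only: pconst_mult mult_ac)
  also have "1 / fact (Suc d) * of_nat (Suc d) = (1 / fact d :: 'a)"
    by (simp add: field_simps del: of_nat_Suc)
  finally show ?thesis by (simp add: dpow_def mult_ac)
qed

lemma pdiffs_dpow:
  assumes "Poly_Mapping.keys m \<subseteq> {..n}"
  shows "pdiffs m (dpow n v d) =
    (if mdeg m \<le> d then pconst (monom_val m v) * dpow n v (d - mdeg m) else 0)"
  using assms
proof (induction m rule: exponent_induct)
  case (add i m)
  then have m: "Poly_Mapping.keys m \<subseteq> {..n}" and i: "i \<le> n"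
    by (auto simp: keys_exponent_add)
  show ?case
  proof (cases "mdeg m < d")
    case True
    then have "d - mdeg m = Suc (d - Suc (mdeg m))" by simp
    then have "pdiff i (dpow n v (d - mdeg m)) = pconst (v i) * dpow n v (d - Suc (mdeg m))"
      by (simp add: pdiff_dpow_Suc[OF i])
    with True show ?thesis
      by (simp only: pdiffs_add_exponent pdiffs_single add.IH[OF m] pdiff_pconst_mult
          mdeg_add mdeg_single monom_val_add monom_val_single pconst_mult)
        (simp add: mult_ac pdiff_pconst_mult)
  next
    case False
    \<comment> \<open>At \<open>mdeg m = d\<close> only a constant is left, which the next
      derivative kills; beyond that the induction hypothesis already gives 0.\<close>
    have "pdiff i (pconst (monom_val m v) * dpow n v 0) = 0"
      by (simp add: pdiff_pconst_mult)
    with False show ?thesis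
      by (simp only: pdiffs_add_exponent pdiffs_single add.IH[OF m] mdeg_add mdeg_single) auto
  qed
qed simp

text \<open>Every monomial of \<open>g\<close> has degree \<open>e\<close>, so all terms leave the
  same divided power, and their scalars add up to the value of \<open>g\<close> at
  \<open>v\<close>.\<close>

lemma diff_act_form_dpow:
  assumes "g \<in> forms n e"
  shows "g \<circ>\<^sub>d dpow n v d = (if e \<le> d then pconst (peval g v) * dpow n v (d - e) else 0)"
proof -
  have "g \<circ>\<^sub>d dpow n v d = (\<Sum>m\<in>Poly_Mapping.keys g. pconst (Poly_Mapping.lookup g m) *
      (if e \<le> d then pconst (monom_val m v) * dpow n v (d - e) else 0))"
    unfolding diff_act_def using assms
    by (intro sum.cong) (auto simp: forms_def polys_def pdiffs_dpow)
  moreover have "pconst (peval g v) =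
      (\<Sum>m\<in>Poly_Mapping.keys g. pconst (Poly_Mapping.lookup g m) * pconst (monom_val m v))"
    unfolding peval_monom_val pconst_mult[symmetric]
    by (induction rule: finite_induct[OF finite_keys]) (auto simp: pconst_add)
  ultimately show ?thesis
    by (simp add: sum_distrib_right mult.assoc)
qed

lemma lookup_dpow_0: "Poly_Mapping.lookup (dpow n v d) 0 = (if d = 0 then 1 else 0)"
proof (cases d)
  case (Suc k)
  have "linear_form n v \<in> forms n 1"
    unfolding linear_form_def by (intro forms_sum forms_pconst_mult forms_pvar) auto
  then have "dpow n v d \<in> forms n (1 * d)"
    unfolding dpow_def by (intro forms_pconst_mult forms_power)
  then show ?thesis
    using Suc by (force simp: forms_def in_keys_iff)
qed simp


section \<open>The coordinate ring of a set of points\<close>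

lemma carrier_polyR [simp]: "carrier (polyR n) = polys n"
  and mult_polyR [simp]: "x \<otimes>\<^bsub>polyR n\<^esub> y = x * y"
  and add_polyR [simp]: "x \<oplus>\<^bsub>polyR n\<^esub> y = x + y"
  and one_polyR [simp]: "\<one>\<^bsub>polyR n\<^esub> = 1"
  and zero_polyR [simp]: "\<zero>\<^bsub>polyR n\<^esub> = 0"
  by (simp_all add: polyR_def)

lemma ring_polyR: "ring (polyR n :: 'k::comm_ring_1 mpol ring)"
  using cring_polyR by (rule cring.axioms(1))

lemma a_inv_polyR [simp]:
  fixes x :: "'k::comm_ring_1 mpol"
  assumes "x \<in> polys n"
  shows "\<ominus>\<^bsub>polyR n\<^esub> x = - x"
proof -
  interpret ring "polyR n :: 'k mpol ring" by (rule ring_polyR)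
  show ?thesis using assms minus_equality[of "- x" x] by (simp add: polys_uminus)
qed

lemma subgroup_polyRI:
  fixes A :: "'k::comm_ring_1 mpol set"
  assumes "A \<subseteq> polys n" "0 \<in> A" "\<And>x y. x \<in> A \<Longrightarrow> y \<in> A \<Longrightarrow> x + y \<in> A" "\<And>x. x \<in> A \<Longrightarrow> - x \<in> A"
  shows "subgroup A (add_monoid (polyR n))"
proof -
  interpret ring "polyR n :: 'k mpol ring" by (rule ring_polyR)
  show ?thesis
    by (rule add.subgroupI) (use assms in \<open>auto simp: subset_iff\<close>)
qed

text \<open>The dimension theory works over a subfield of the ring itself, so the ground field
  enters as the constant polynomials.\<close>

lemma subfield_constants: "subfield (range pconst) (polyR n :: 'k::field mpol ring)"
proof -
  interpret cring "polyR n :: 'k mpol ring" by (rule cring_polyR)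
  have uminus: "- pconst c \<in> range pconst" for c :: 'k
    by (metis pconst_uminus rangeI)
  have "subring (range pconst) (polyR n :: 'k mpol ring)"
  proof (rule subringI)
    show "range pconst \<subseteq> carrier (polyR n :: 'k mpol ring)" by auto
    show "\<one>\<^bsub>polyR n\<^esub> \<in> range (pconst :: 'k \<Rightarrow> _)"
      by (metis one_polyR pconst_1 rangeI)
    show "\<ominus>\<^bsub>polyR n\<^esub> x \<in> range pconst" if "x \<in> range pconst" for x :: "'k mpol"
      using that uminus by auto
    show "x \<otimes>\<^bsub>polyR n\<^esub> y \<in> range pconst" if "x \<in> range pconst" "y \<in> range pconst" for x y :: "'k mpol"
      using that by (auto simp flip: pconst_mult)
    show "x \<oplus>\<^bsub>polyR n\<^esub> y \<in> range pconst" if "x \<in> range pconst" "y \<in> range pconst" for x y :: "'k mpol"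
      using that by (auto simp flip: pconst_add)
  qed
  then have "subcring (range pconst) (polyR n :: 'k mpol ring)"
    by (rule subcringI')
  moreover have "Units (polyR n\<lparr>carrier := range pconst\<rparr>) = range pconst - {0 :: 'k mpol}"
  proof (intro equalityI subsetI)
    fix x :: "'k mpol" assume "x \<in> Units (polyR n\<lparr>carrier := range pconst\<rparr>)"
    then have "x \<in> range pconst" "\<exists>y. y * x = 1"
      by (auto simp: Units_def polyR_def)
    then show "x \<in> range pconst - {0}" by auto
  next
    fix x :: "'k mpol" assume "x \<in> range pconst - {0}"
    then obtain c where c: "x = pconst c" "c \<noteq> 0"
      by (metis DiffE imageE insertI1 pconst_0)
    then have "pconst (1 / c) * x = 1" "x * pconst (1 / c) = 1"
      by (simp_all flip: pconst_mult)
    then show "x \<in> Units (polyR n\<lparr>carrier := range pconst\<rparr>)"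
      unfolding Units_def c(1) polyR_def by simp blast
  qed
  ultimately show ?thesis
    by (intro subfieldI) auto
qed

section \<open>Finite dimension of the graded pieces\<close>

text \<open>The list of the \<open>n + 1\<close> entries determines the vector, and no entry exceeds
  \<open>d\<close>.\<close>

lemma finite_exponents: "finite {m. Poly_Mapping.keys m \<subseteq> {..n} \<and> mdeg m = d}"
proof (rule finite_imageD)
  let ?\<phi> = "\<lambda>m. map (Poly_Mapping.lookup m) [0..<Suc n]"
  let ?M = "{m. Poly_Mapping.keys m \<subseteq> {..n} \<and> mdeg m = d}"
  have "Poly_Mapping.lookup m i \<le> d" if "m \<in> ?M" for m i
  proof (cases "i \<in> Poly_Mapping.keys m")
    case True
    then have "Poly_Mapping.lookup m i \<le> mdeg m"
      unfolding mdeg_def by (intro member_le_sum) auto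
    then show ?thesis using that by simp
  qed (simp add: in_keys_iff)
  then have "?\<phi> ` ?M \<subseteq> {xs. set xs \<subseteq> {..d} \<and> length xs = Suc n}"
    by fastforce
  then show "finite (?\<phi> ` ?M)"
    by (rule finite_subset) (rule finite_lists_length_eq, simp)
  show "inj_on ?\<phi> ?M"
  proof (rule inj_onI, rule poly_mapping_eqI)
    fix x y i assume "x \<in> ?M" "y \<in> ?M" "?\<phi> x = ?\<phi> y"
    then have "i \<le> n \<Longrightarrow> Poly_Mapping.lookup x i = Poly_Mapping.lookup y i"
      "\<not> i \<le> n \<Longrightarrow> i \<notin> Poly_Mapping.keys x" "\<not> i \<le> n \<Longrightarrow> i \<notin> Poly_Mapping.keys y"
      by auto
    then show "Poly_Mapping.lookup x i = Poly_Mapping.lookup y i"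
      by (cases "i \<le> n") (simp_all add: in_keys_iff)
  qed
qed

text \<open>The spanning list consists of the monomials of degree \<open>d\<close>. It supplies the
  finite dimension behind the argument that injective implies surjective.\<close>

lemma forms_eq_Span:
  obtains Us where "set Us \<subseteq> polys n"
    and "forms n d = ring.Span (polyR n) (range pconst) (Us :: 'k::field mpol list)"
proof -
  interpret ring "polyR n :: 'k mpol ring" by (rule ring_polyR)
  obtain ms where ms: "set ms = {m. Poly_Mapping.keys m \<subseteq> {..n} \<and> mdeg m = d}"
    using finite_list[OF finite_exponents] by metis
  define Us where "Us = map (\<lambda>m. Poly_Mapping.single m (1::'k)) ms"
  have Us: "set Us \<subseteq> forms n d"
    using ms by (auto simp: Us_def forms_def polys_def)
  then have Us': "set Us \<subseteq> carrier (polyR n)"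
    by (auto simp: forms_def)
  have "subalgebra (range pconst) (forms n d) (polyR n :: 'k mpol ring)"
    by (intro subalgebra.intro subalgebra_axioms.intro subgroup_polyRI)
      (auto simp: forms_imp_polys forms_add forms_uminus forms_pconst_mult)
  then have "Span (range pconst) Us \<subseteq> forms n d"
    using subalgebra_Span_incl[OF subfield_constants] Us by blast
  moreover have "f \<in> Span (range pconst) Us" if "f \<in> forms n d" for f
    using that
  proof (induction f rule: update_induct)
    case const
    then show ?case using Span_subgroup_props(2)[OF subfield_constants Us'] by simp
  next
    case (update f m c)
    \<comment> \<open>The new coefficient is nonzero, so no cancellation hides a key:
      \<open>f\<close> is itself a form of degree \<open>d\<close> and \<open>m\<close> is one of
      the listed exponents.\<close>
    have keys: "Poly_Mapping.keys (Poly_Mapping.update m c f) = insert m (Poly_Mapping.keys f)"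
      using update(2) by (simp add: keys_update)
    have f: "f \<in> forms n d" and "m \<in> set ms"
      using update(4) by (auto simp: forms_def polys_def keys ms)
    then have "Poly_Mapping.single m 1 \<in> set Us" by (auto simp: Us_def)
    then have "Poly_Mapping.single m 1 \<in> Span (range pconst) Us"
      using Span_base_incl[OF subfield_constants Us'] by blast
    then have "pconst c \<otimes>\<^bsub>polyR n\<^esub> Poly_Mapping.single m 1 \<in> Span (range pconst) Us"
      by (intro Span_smult_closed[OF subfield_constants Us']) auto
    then have "Poly_Mapping.single m c \<in> Span (range pconst) Us"
      by (simp add: pconst_def mult_single)
    from Span_subgroup_props(3)[OF subfield_constants Us' this update(3)[OF f]]
    show ?case using update(1) by (simp add: update_eq_single_add)
  qed
  ultimately have "forms n d = Span (range pconst) Us" by (intro equalityI subsetI) (auto simp del: Span.simps)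
  then show thesis using that Us' by (simp del: Span.simps)
qed

text \<open>An injective linear map between spaces of equal finite dimension is onto: multiplying a
  basis of \<open>E\<close> by \<open>u\<close> gives an independent list in \<open>E'\<close> whose
  length is the dimension of \<open>E'\<close>.\<close>

lemma (in ring) mult_image_eq_of_dim_eq:
  assumes K: "subfield K R" and E: "finite_dimension K E" and E': "finite_dimension K E'"
    and dim: "dim K E = dim K E'"
    and u: "u \<in> carrier R"
    and inj: "\<And>x. x \<in> E \<Longrightarrow> x \<otimes> u = \<zero> \<Longrightarrow> x = \<zero>"
    and maps: "\<And>x. x \<in> E \<Longrightarrow> x \<otimes> u \<in> E'"
  shows "(\<lambda>x. x \<otimes> u) ` E = E'"
proof
  obtain Us where Us: "set Us \<subseteq> carrier R" "independent K Us" "length Us = dim K E" "Span K Us = E"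
    using exists_base[OF K finite_dimensionE[OF K E]] by (auto simp: over_def)
  have Kc: "K \<subseteq> carrier R" using subfieldE(3)[OF K] .
  define Vs where "Vs = map (\<lambda>x. x \<otimes> u) Us"
  have combine: "combine Ks Vs = combine Ks Us \<otimes> u" if "set Ks \<subseteq> K" for Ks
    using combine_l_distr[OF _ Us(1) u, of Ks] that Kc by (auto simp: Vs_def)
  have Vs: "set Vs \<subseteq> carrier R" using Us(1) u by (auto simp: Vs_def)
  have in_E: "combine Ks Us \<in> E" if "set Ks \<subseteq> K" for Ks
    using that Span_eq_combine_set[OF K Us(1)] Us(4) by blast
  have "independent K Vs"
  proof (rule trivial_combine_imp_independent[OF K Vs])
    fix Ks assume Ks: "set Ks \<subseteq> K" "combine Ks Vs = \<zero>"
    then have "combine Ks Us = \<zero>"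
      using inj in_E combine by metis
    then show "set (take (length Vs) Ks) \<subseteq> {\<zero>}"
      using independent_imp_trivial_combine[OF K Us(2) Ks(1)] by (simp add: Vs_def)
  qed
  moreover have "set Vs \<subseteq> E'"
    using maps Span_base_incl[OF K Us(1)] Us(4) by (auto simp: Vs_def)
  moreover have "length Vs = (dim over K) E'"
    using Us(3) dim by (simp add: Vs_def over_def)
  ultimately have "Span K Vs = E'"
    using independent_length_eq_dimension[OF K finite_dimensionE[OF K E']] by blast
  then show "E' \<subseteq> (\<lambda>x. x \<otimes> u) ` E"
    using Span_eq_combine_set[OF K Vs] combine in_E by auto
qed (use maps in auto)

section \<open>Projective points, normalized representatives and the vanishing ideal\<close>

lemma equiv_proj_rel: "equiv (hvecs n) (proj_rel n :: ((nat \<Rightarrow> 'k::field) \<times> _) set)"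
proof (rule equivI)
  show "(proj_rel n :: ((nat \<Rightarrow> 'k) \<times> _) set) \<subseteq> hvecs n \<times> hvecs n"
    by (auto simp: proj_rel_def)
  show "refl_on (hvecs n) (proj_rel n :: ((nat \<Rightarrow> 'k) \<times> _) set)"
    by (auto simp: refl_on_def proj_rel_def intro!: exI[of _ 1])
  show "sym (proj_rel n :: ((nat \<Rightarrow> 'k) \<times> _) set)"
  proof (rule symI)
    fix x y :: "nat \<Rightarrow> 'k"
    assume "(x, y) \<in> proj_rel n"
    then obtain c where "x \<in> hvecs n" "y \<in> hvecs n" "c \<noteq> 0" "y = (\<lambda>j. c * x j)"
      by (auto simp: proj_rel_def)
    then show "(y, x) \<in> proj_rel n"
      by (auto simp: proj_rel_def intro!: exI[of _ "1 / c"])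
  qed
  show "trans (proj_rel n :: ((nat \<Rightarrow> 'k) \<times> _) set)"
  proof (rule transI)
    fix x y z :: "nat \<Rightarrow> 'k"
    assume "(x, y) \<in> proj_rel n" "(y, z) \<in> proj_rel n"
    then obtain c d where "x \<in> hvecs n" "z \<in> hvecs n" "c \<noteq> 0" "d \<noteq> 0"
      "y = (\<lambda>j. c * x j)" "z = (\<lambda>j. d * y j)"
      by (auto simp: proj_rel_def)
    then show "(x, z) \<in> proj_rel n"
      by (auto simp: proj_rel_def intro!: exI[of _ "d * c"])
  qed
qed

text \<open>The condition \<open>a_last\<close> says that \<open>pvar n\<close> has value 1 at every
  representative. Multiplication by it therefore raises the degree of a form without changing its
  values on the representatives.\<close>

locale affine_points =
  fixes n r :: nat and P :: "nat \<Rightarrow> (nat \<Rightarrow> 'k::field) set" and a :: "nat \<Rightarrow> nat \<Rightarrow> 'k"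
  assumes inj_P: "inj_on P {1..r}"
    and P_proj: "P ` {1..r} \<subseteq> proj_space n"
    and a_mem: "\<And>i. i \<in> {1..r} \<Longrightarrow> a i \<in> P i"
    and a_last: "\<And>i. i \<in> {1..r} \<Longrightarrow> a i n = 1"
begin

abbreviation "X \<equiv> P ` {1..r}"
abbreviation "I \<equiv> vanishing_ideal n X"

lemma a_hvecs: "i \<in> {1..r} \<Longrightarrow> a i \<in> hvecs n"
  using a_mem P_proj in_quotient_imp_subset[OF equiv_proj_rel]
  unfolding proj_space_def by blast

lemma mem_P_imp_multiple:
  assumes "i \<in> {1..r}" "v \<in> P i"
  obtains c where "v = (\<lambda>j. c * a i j)"
proof -
  have "P i \<in> hvecs n // proj_rel n" using assms P_proj by (auto simp: proj_space_def)
  then have "(a i, v) \<in> proj_rel n"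
    using quotient_eq_iff[OF equiv_proj_rel] assms a_mem by metis
  then show thesis using that by (auto simp: proj_rel_def)
qed

lemma inj_a: "inj_on a {1..r}"
proof (rule inj_onI)
  fix i j assume ij: "i \<in> {1..r}" "j \<in> {1..r}" "a i = a j"
  then have "P i \<in> hvecs n // proj_rel n" "P j \<in> hvecs n // proj_rel n"
    using P_proj by (auto simp: proj_space_def)
  then have "P i = P j"
    using quotient_disj[OF equiv_proj_rel] a_mem[OF ij(1)] a_mem[OF ij(2)] ij(3)
    by (metis disjoint_iff)
  then show "i = j" using inj_P ij by (auto dest: inj_onD)
qed

text \<open>Every vector in the class \<open>P i\<close> is a multiple of \<open>a i\<close>, so
  homogeneity carries vanishing at \<open>a i\<close> to the whole class.\<close>

lemma subset_proj_zeros_iff: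
  assumes "f \<in> forms n d"
  shows "X \<subseteq> proj_zeros n f \<longleftrightarrow> (\<forall>i\<in>{1..r}. peval f (a i) = 0)"
proof
  assume "\<forall>i\<in>{1..r}. peval f (a i) = 0"
  then have "peval f v = 0" if "i \<in> {1..r}" "v \<in> P i" for i v
    using mem_P_imp_multiple[OF that] peval_scale[OF assms] that(1) by (metis mult_zero_right)
  then show "X \<subseteq> proj_zeros n f"
    using P_proj by (auto simp: proj_zeros_def)
qed (use a_mem in \<open>auto simp: proj_zeros_def\<close>)

lemma vanishing_ideal_ideal: "ideal I (polyR n)"
  unfolding vanishing_ideal_def
  by (rule ring.genideal_ideal[OF ring_polyR]) (auto simp: forms_imp_polys)

text \<open>The polynomials vanishing at \<open>a i\<close> form an ideal that contains all
  generators of \<open>I\<close>, hence contains \<open>I\<close>.\<close>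

lemma vanishing_ideal_imp_peval:
  assumes "f \<in> I" "i \<in> {1..r}"
  shows "peval f (a i) = 0"
proof -
  let ?Z = "{f \<in> polys n. peval f (a i) = 0}"
  have "ideal ?Z (polyR n)"
    by (intro idealI ring_polyR subgroup_polyRI)
      (auto simp: polys_add polys_uminus polys_mult peval_add peval_uminus peval_mult)
  then have "I \<subseteq> ?Z"
    unfolding vanishing_ideal_def
    by (rule ring.genideal_minimal[OF ring_polyR])
      (use assms(2) subset_proj_zeros_iff in \<open>auto simp: forms_imp_polys\<close>)
  then show ?thesis using assms by blast
qed

lemma form_in_vanishing_ideal:
  assumes "f \<in> forms n d" "\<And>i. i \<in> {1..r} \<Longrightarrow> peval f (a i) = 0"
  shows "f \<in> I"
proof -
  have "{f. (\<exists>d. f \<in> forms n d) \<and> X \<subseteq> proj_zeros n f} \<subseteq> I"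
    unfolding vanishing_ideal_def
    by (rule ring.genideal_self[OF ring_polyR]) (auto simp: forms_imp_polys)
  then show ?thesis using assms subset_proj_zeros_iff[OF assms(1)] by blast
qed

section \<open>From the Hilbert function to interpolation\<close>

text \<open>Multiplication by \<open>pvar n\<close> from degree \<open>t\<close> to degree
  \<open>Suc t\<close> of the coordinate ring is injective, hence onto when the dimensions agree.
  Thus \<open>f\<close> equals some \<open>g * pvar n\<close> modulo \<open>I\<close>, and
  \<open>pvar n\<close> has value 1 at the representatives.\<close>

lemma hilbert_fun_eq_imp_agree:
  assumes "r > 0" and eq: "hilbert_fun n X (Suc t) = hilbert_fun n X t" and f: "f \<in> forms n (Suc t)"
  shows "\<exists>g\<in>forms n t. \<forall>i\<in>{1..r}. peval g (a i) = peval f (a i)"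
proof -
  interpret I: ideal I "polyR n" by (rule vanishing_ideal_ideal)
  let ?Q = "polyR n Quot I" and ?h = "\<lambda>f. I +>\<^bsub>polyR n\<^esub> f"
  interpret h: ring_hom_ring "polyR n" ?Q ?h by (rule I.rcos_ring_hom_ring)
  let ?K = "?h ` range pconst" and ?E = "\<lambda>t. ?h ` forms n t"
  have h_0: "?h f = \<zero>\<^bsub>?Q\<^esub> \<longleftrightarrow> f \<in> I" if "f \<in> polys n" for f
    using that I.rcos_const_imp_mem I.a_rcos_const by (auto simp: FactRing_def)
  \<comment> \<open>Having at least one point keeps 1 out of \<open>I\<close>, so the constants
    still form a field in the quotient.\<close>
  have one: "\<one>\<^bsub>?Q\<^esub> \<noteq> \<zero>\<^bsub>?Q\<^esub>"
  proof
    assume "\<one>\<^bsub>?Q\<^esub> = \<zero>\<^bsub>?Q\<^esub>"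
    then have "1 \<in> I" using h_0[of 1] h.hom_one by simp
    then show False using vanishing_ideal_imp_peval[of 1 1] \<open>r > 0\<close> by simp
  qed
  have K: "subfield ?K ?Q"
    by (rule h.img_is_subfield(2)[OF subfield_constants one])
  have fin: "h.S.finite_dimension ?K (?E d)" for d
  proof -
    obtain Us where Us: "set Us \<subseteq> polys n" "forms n d = I.Span (range pconst) Us"
      by (rule forms_eq_Span)
    have "?E d = h.S.Span ?K (map ?h Us)"
      unfolding Us(2) by (rule h.Span_hom[symmetric]) (use Us(1) in auto)
    then show ?thesis
      using h.S.Span_finite_dimension[OF K, of "map ?h Us"] Us(1) h.hom_closed
      by (auto simp: subset_iff)
  qed
  have hf: "hilbert_fun n X d = h.S.dim ?K (?E d)" for d
    by (simp add: hilbert_fun_def Let_def image_image)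
  have x: "(pvar n :: 'k mpol) \<in> polys n" by (simp add: polys_pvar)
  have mult_x: "?h g \<otimes>\<^bsub>?Q\<^esub> ?h (pvar n) = ?h (g * pvar n)" if "g \<in> polys n" for g
    using h.hom_mult[of g "pvar n", symmetric] that x by (simp only: carrier_polyR mult_polyR)
  have form_x: "g * pvar n \<in> forms n (Suc t)" if "g \<in> forms n t" for g :: "'k mpol"
    using forms_mult[OF that forms_pvar[of n n]] by simp
  have "(\<lambda>y. y \<otimes>\<^bsub>?Q\<^esub> ?h (pvar n)) ` ?E t = ?E (Suc t)"
  proof (rule h.S.mult_image_eq_of_dim_eq[OF K fin fin])
    show "h.S.dim ?K (?E t) = h.S.dim ?K (?E (Suc t))"
      using eq unfolding hf by simp
    show "?h (pvar n) \<in> carrier ?Q" using x by (intro h.hom_closed) simp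
  next
    fix y assume y: "y \<in> ?E t" "y \<otimes>\<^bsub>?Q\<^esub> ?h (pvar n) = \<zero>\<^bsub>?Q\<^esub>"
    then obtain g where g: "g \<in> forms n t" "y = ?h g" by blast
    then have "g * pvar n \<in> I"
      using y(2) mult_x[of g] h_0[of "g * pvar n"] by (simp add: forms_imp_polys polys_mult x)
    then have "peval g (a i) = 0" if "i \<in> {1..r}" for i
      using vanishing_ideal_imp_peval[OF _ that] a_last[OF that] by (fastforce simp: peval_mult)
    then have "g \<in> I" by (rule form_in_vanishing_ideal[OF g(1)])
    then show "y = \<zero>\<^bsub>?Q\<^esub>" using h_0 g by (simp add: forms_imp_polys)
  next
    fix y assume "y \<in> ?E t"
    then obtain g where "g \<in> forms n t" "y = ?h g" by blast
    then show "y \<otimes>\<^bsub>?Q\<^esub> ?h (pvar n) \<in> ?E (Suc t)"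
      using mult_x[of g] form_x[of g] by (simp add: forms_imp_polys)
  qed
  then have "?h f \<in> (\<lambda>y. y \<otimes>\<^bsub>?Q\<^esub> ?h (pvar n)) ` ?E t"
    using f by simp
  then obtain g where g: "g \<in> forms n t" "?h f = ?h g \<otimes>\<^bsub>?Q\<^esub> ?h (pvar n)"
    by blast
  have gx: "g * pvar n \<in> polys n" "f \<in> polys n" using g f form_x forms_imp_polys by blast+
  have "?h f = ?h (g * pvar n)" using g mult_x by (simp add: forms_imp_polys)
  then have "f \<in> ?h (g * pvar n)"
    using I.a_rcos_self gx by (metis carrier_polyR)
  then obtain q where "q \<in> I" "f = q + g * pvar n"
    by (auto simp: a_r_coset_def')
  then have "peval g (a i) = peval f (a i)" if "i \<in> {1..r}" for i
    using vanishing_ideal_imp_peval[OF _ that] a_last[OF that] by (simp add: peval_add peval_mult)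
  then show ?thesis using g by blast
qed

text \<open>One linear form for each other point, 1 at \<open>a i\<close> and 0 at that point, gives
  a product of degree \<open>r - 1\<close>; a power of \<open>pvar n\<close> pads the degree to
  \<open>e\<close>.\<close>

lemma exists_separating_form:
  assumes "r \<le> Suc e" "i \<in> {1..r}"
  obtains g where "g \<in> forms n e" "\<And>j. j \<in> {1..r} \<Longrightarrow> peval g (a j) = (if j = i then 1 else 0)"
proof -
  have "\<exists>l. l \<in> forms n 1 \<and> peval l (a i) = 1 \<and> peval l (a j) = 0" if j: "j \<in> {1..r} - {i}" for j
  proof -
    have "a i \<noteq> a j" using j assms(2) inj_a by (auto dest: inj_onD)
    then obtain k where k: "a i k \<noteq> a j k" by blast
    have "k \<le> n"
    proof (rule ccontr)
      assume "\<not> k \<le> n"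
      then show False using a_hvecs[of i] a_hvecs[of j] assms(2) j k by (auto simp: hvecs_def)
    qed
    \<comment> \<open>Both last coordinates are 1, so the unscaled form takes the value
      \<open>a i k - a j k\<close> at \<open>a i\<close> and 0 at \<open>a j\<close>.\<close>
    let ?l = "pconst (1 / (a i k - a j k)) * (pvar k - pconst (a j k) * pvar n)"
    have "?l \<in> forms n 1"
      using \<open>k \<le> n\<close> by (intro forms_pconst_mult forms_diff forms_pvar) auto
    moreover have "peval ?l (a i) = 1" "peval ?l (a j) = 0"
      using k a_last[of i] a_last[of j] assms(2) j by (simp_all add: peval_mult peval_diff)
    ultimately show ?thesis by blast
  qed
  then obtain l where l: "\<And>j. j \<in> {1..r} - {i} \<Longrightarrow>
    l j \<in> forms n 1 \<and> peval (l j) (a i) = 1 \<and> peval (l j) (a j) = 0"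
    by metis
  define g where "g = (\<Prod>j\<in>{1..r} - {i}. l j) * pvar n ^ (e - (r - 1))"
  have "(\<Prod>j\<in>{1..r} - {i}. l j) \<in> forms n (card ({1..r} - {i}))"
    using l by (intro forms_prod) auto
  then have "g \<in> forms n (card ({1..r} - {i}) + 1 * (e - (r - 1)))"
    unfolding g_def by (intro forms_mult forms_power forms_pvar) auto
  moreover have "card ({1..r} - {i}) + 1 * (e - (r - 1)) = e"
    using assms by simp
  ultimately have "g \<in> forms n e" by metis
  moreover have "peval g (a j) = (if j = i then 1 else 0)" if j: "j \<in> {1..r}" for j
  proof (cases "j = i")
    case True
    then show ?thesis using l a_last[OF j] by (simp add: g_def peval_mult peval_prod peval_power)
  next
    case False
    then have "(\<Prod>k\<in>{1..r} - {i}. peval (l k) (a j)) = 0"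
      using l[of j] j by (intro prod_zero) auto
    with False show ?thesis by (simp add: g_def peval_mult peval_prod)
  qed
  ultimately show thesis by (rule that)
qed

lemma interpolation_large_degree:
  assumes "r \<le> Suc e"
  shows "\<exists>g\<in>forms n e. \<forall>i\<in>{1..r}. peval g (a i) = c i"
proof -
  obtain g where g: "\<And>i. i \<in> {1..r} \<Longrightarrow> g i \<in> forms n e"
    "\<And>i j. i \<in> {1..r} \<Longrightarrow> j \<in> {1..r} \<Longrightarrow> peval (g i) (a j) = (if j = i then 1 else 0)"
  proof -
    have "\<forall>i\<in>{1..r}. \<exists>g\<in>forms n e. \<forall>j\<in>{1..r}. peval g (a j) = (if j = i then 1 else 0)"
      using exists_separating_form[OF assms] by (metis (full_types))
    then show thesis using that by (metis (full_types))
  qed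
  have peval_sum: "peval (sum f A) v = (\<Sum>i\<in>A. peval (f i) v)" for f :: "nat \<Rightarrow> 'k mpol" and A v
    by (induction A rule: infinite_finite_induct) (auto simp: peval_add)
  show ?thesis
  proof (intro bexI ballI)
    show "(\<Sum>i\<in>{1..r}. pconst (c i) * g i) \<in> forms n e"
      using g by (intro forms_sum forms_pconst_mult)
    fix j assume j: "j \<in> {1..r}"
    have "peval (\<Sum>i\<in>{1..r}. pconst (c i) * g i) (a j) = (\<Sum>i\<in>{1..r}. if j = i then c i else 0)"
      unfolding peval_sum peval_mult by (intro sum.cong) (use g(2) j in auto)
    then show "peval (\<Sum>i\<in>{1..r}. pconst (c i) * g i) (a j) = c j"
      using j by simp
  qed
qed

text \<open>Descending induction from \<open>max e r\<close>, where products of linear forms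
  interpolate. Each step passes from \<open>Suc t\<close> to \<open>t\<close> with \<open>t\<close>
  at least \<open>s\<close>, where the Hilbert function no longer changes.\<close>

lemma interpolation:
  assumes "r > 0" "has_socle_degree n X s" "e \<ge> s"
  shows "\<exists>g\<in>forms n e. \<forall>i\<in>{1..r}. peval g (a i) = c i"
proof -
  have "e \<le> max e r" by simp
  then show ?thesis
  proof (induction e rule: inc_induct)
    case base
    show ?case by (rule interpolation_large_degree) simp
  next
    case (step t)
    have "s < Suc t" using step assms(3) by simp
    then have "hilbert_diff n X (Suc t) = 0"
      using assms(2) by (auto simp: has_socle_degree_def)
    then have "hilbert_fun n X (Suc t) = hilbert_fun n X t"
      by (simp add: hilbert_diff_def)
    from hilbert_fun_eq_imp_agree[OF assms(1) this] step(3) show ?case by metis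
  qed
qed

end


section \<open>Combinations of divided powers\<close>

definition dpow_comb ::
    "nat \<Rightarrow> 'i set \<Rightarrow> ('i \<Rightarrow> nat \<Rightarrow> 'k::field_char_0) \<Rightarrow> nat \<Rightarrow> (nat \<Rightarrow> 'i \<Rightarrow> 'k) \<Rightarrow> 'k mpol" where
  "dpow_comb n A v D c = (\<Sum>d<D. \<Sum>i\<in>A. pconst (c d i) * dpow n (v i) d)"

text \<open>This serves as an upper bound for the inverse system: being a submodule that contains
  all \<open>F t\<close>, it contains everything they generate.\<close>

definition dpow_span :: "nat \<Rightarrow> 'i set \<Rightarrow> ('i \<Rightarrow> nat \<Rightarrow> 'k::field_char_0) \<Rightarrow> 'k mpol set" where
  "dpow_span n A v = {dpow_comb n A v D c |D c. True}"

lemma dpow_comb_extend: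
  assumes "D \<le> D'"
  shows "dpow_comb n A v D c = dpow_comb n A v D' (\<lambda>d i. if d < D then c d i else 0)"
  unfolding dpow_comb_def by (rule sum.mono_neutral_cong_left) (use assms in auto)

lemma dpow_comb_add:
  "dpow_comb n A v D c + dpow_comb n A v D c' = dpow_comb n A v D (\<lambda>d i. c d i + c' d i)"
  by (simp add: dpow_comb_def sum.distrib pconst_add distrib_right)

lemma pconst_mult_dpow_comb:
  "pconst k * dpow_comb n A v D c = dpow_comb n A v D (\<lambda>d i. k * c d i)"
  by (simp add: dpow_comb_def sum_distrib_left pconst_mult mult.assoc)

lemma dpow_span_add:
  assumes "x \<in> dpow_span n A v" "y \<in> dpow_span n A v"
  shows "x + y \<in> dpow_span n A v"
proof -
  obtain D c D' c' where "x = dpow_comb n A v D c" "y = dpow_comb n A v D' c'"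
    using assms by (auto simp: dpow_span_def)
  moreover define M where "M = max D D'"
  ultimately have "x = dpow_comb n A v M (\<lambda>d i. if d < D then c d i else 0)"
    "y = dpow_comb n A v M (\<lambda>d i. if d < D' then c' d i else 0)"
    using dpow_comb_extend[of D M] dpow_comb_extend[of D' M] by simp_all
  then show ?thesis unfolding dpow_span_def using dpow_comb_add by blast
qed

lemma dpow_span_pconst_mult: "x \<in> dpow_span n A v \<Longrightarrow> pconst k * x \<in> dpow_span n A v"
  unfolding dpow_span_def using pconst_mult_dpow_comb by blast

lemma dpow_span_0: "0 \<in> dpow_span n A v"
proof -
  have "0 = dpow_comb n A v 0 (\<lambda>d i. 0)" by (simp add: dpow_comb_def)
  then show ?thesis unfolding dpow_span_def by blast
qed

lemma dpow_span_uminus: "x \<in> dpow_span n A v \<Longrightarrow> - x \<in> dpow_span n A v"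
  using dpow_span_pconst_mult[of x n A v "- 1"] by (simp add: pconst_uminus)

lemma dpow_span_sum:
  "(\<And>i. i \<in> B \<Longrightarrow> f i \<in> dpow_span n A v) \<Longrightarrow> sum f B \<in> dpow_span n A v"
  by (induction B rule: infinite_finite_induct) (auto simp: dpow_span_0 dpow_span_add)

lemma dpow_in_dpow_span:
  assumes "finite A" "i \<in> A"
  shows "dpow n (v i) d \<in> dpow_span n A v"
proof -
  have "(\<Sum>j\<in>A. pconst (if e = d \<and> j = i then 1 else 0) * dpow n (v j) e) =
      (if e = d then dpow n (v i) d else 0)" for e
  proof -
    have "(\<Sum>j\<in>A. pconst (if e = d \<and> j = i then 1 else 0) * dpow n (v j) e) =
      (\<Sum>j\<in>A. if j = i then (if e = d then dpow n (v j) d else 0) else 0)"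
      by (intro sum.cong) auto
    then show ?thesis using assms by simp
  qed
  then have "dpow n (v i) d = dpow_comb n A v (Suc d) (\<lambda>e j. if e = d \<and> j = i then 1 else 0)"
    by (simp add: dpow_comb_def)
  then show ?thesis unfolding dpow_span_def by blast
qed

lemma dpow_span_subset_polys: "dpow_span n A v \<subseteq> polys n"
  by (auto simp: dpow_span_def dpow_comb_def intro!: polys_sum polys_mult dpow_in_polys)

lemma diff_act_dpow_in_dpow_span:
  assumes "finite A" "i \<in> A" "f \<in> polys n"
  shows "f \<circ>\<^sub>d dpow n (v i) d \<in> dpow_span n A v"
  unfolding diff_act_def
proof (intro dpow_span_sum dpow_span_pconst_mult)
  fix m assume "m \<in> Poly_Mapping.keys f"
  then have "Poly_Mapping.keys m \<subseteq> {..n}" using assms(3) by (auto simp: polys_def)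
  then show "pdiffs m (dpow n (v i) d) \<in> dpow_span n A v"
    using assms(1,2) by (simp add: pdiffs_dpow dpow_span_0 dpow_span_pconst_mult dpow_in_dpow_span)
qed

lemma diff_act_in_dpow_span:
  assumes "finite A" "f \<in> polys n" "x \<in> dpow_span n A v"
  shows "f \<circ>\<^sub>d x \<in> dpow_span n A v"
proof -
  obtain D c where x: "x = dpow_comb n A v D c"
    using assms(3) by (auto simp: dpow_span_def)
  show ?thesis
    unfolding x dpow_comb_def diff_act_sum_right diff_act_pconst_right
    by (intro dpow_span_sum dpow_span_pconst_mult diff_act_dpow_in_dpow_span assms)
qed

text \<open>Both structures have the same addition, so the known negation of \<open>polyR\<close>
  can be reused.\<close>

lemma a_inv_polyGamma:
  fixes x :: "'k::comm_ring_1 mpol"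
  shows "inv\<^bsub>add_monoid (polyGamma n)\<^esub> x = \<ominus>\<^bsub>polyR n\<^esub> x"
  by (simp add: a_inv_def m_inv_def polyGamma_def polyR_def)

lemma submodule_dpow_span:
  assumes "finite A"
  shows "submodule (dpow_span n A v) (polyR n) (polyGamma n)"
proof (intro submodule.intro subgroup.intro submodule_axioms.intro)
  fix x assume x: "x \<in> dpow_span n A v"
  then show "inv\<^bsub>add_monoid (polyGamma n)\<^esub> x \<in> dpow_span n A v"
    using subsetD[OF dpow_span_subset_polys x] by (simp add: a_inv_polyGamma dpow_span_uminus)
qed (use assms dpow_span_subset_polys in
    \<open>auto simp: polyGamma_def polyR_def dpow_span_add dpow_span_0 diff_act_in_dpow_span\<close>)

section \<open>Coefficient extraction, positivity of the socle degree, and sums of ideals\<close>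

text \<open>The form kills all layers of degree below \<open>e\<close> and leaves the layers above
  without constant term, so the constant term sees layer \<open>e\<close> alone.\<close>

lemma lookup_form_act_dpow_comb:
  fixes g :: "'k::field_char_0 mpol"
  assumes "g \<in> forms n e" "e < D"
  shows "Poly_Mapping.lookup (g \<circ>\<^sub>d dpow_comb n A v D c) 0 = (\<Sum>i\<in>A. c e i * peval g (v i))"
proof -
  have lookup_pconst_0: "Poly_Mapping.lookup (pconst k) 0 = k" for k :: 'k
    by (simp add: pconst_def)
  have "Poly_Mapping.lookup (g \<circ>\<^sub>d dpow_comb n A v D c) 0 =
    (\<Sum>d<D. \<Sum>i\<in>A. c d i * (if d = e then peval g (v i) else 0))"
    unfolding dpow_comb_def diff_act_sum_right diff_act_pconst_right lookup_sum lookup_pconst_mult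
    by (intro sum.cong refl)
      (auto simp: diff_act_form_dpow[OF assms(1)] lookup_pconst_mult lookup_dpow_0 lookup_pconst_0)
  also have "\<dots> = (\<Sum>d<D. if d = e then \<Sum>i\<in>A. c d i * peval g (v i) else 0)"
    by (intro sum.cong) auto
  finally show ?thesis using assms(2) by simp
qed

text \<open>If \<open>s = 0\<close>, constants interpolate all values on \<open>X\<close>, so the
  coordinate 0 equals one \<open>k\<close> at all representatives and
  \<open>pvar 0 - pconst k * pvar n\<close> cuts out a hyperplane through \<open>X\<close>.
  Positivity makes every \<open>t \<ge> s\<close> a legal index of \<open>F\<close>.\<close>

lemma (in affine_points) socle_degree_pos:
  assumes "n \<ge> 1" "\<not> in_hyperplane n X" "has_socle_degree n X s"
  shows "s > 0"
proof (rule ccontr)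
  assume "\<not> s > 0"
  have "\<exists>k. \<forall>i\<in>{1..r}. a i 0 = k"
  proof (cases "r = 0")
    case False
    then obtain g where g: "g \<in> forms n 0" "\<forall>i\<in>{1..r}. peval g (a i) = a i 0"
      using interpolation[OF _ assms(3), of 0 "\<lambda>i. a i 0"] \<open>\<not> s > 0\<close> by auto
    \<comment> \<open>Scaling by 0 in degree 0 has the factor \<open>0 ^ 0 = 1\<close>, so
      \<open>g\<close> is constant.\<close>
    have "peval g v = peval g (\<lambda>_. 0)" for v
      using peval_scale[OF g(1), of 0 v] by simp
    then show ?thesis using g(2) by metis
  qed simp
  then obtain k where k: "\<forall>i\<in>{1..r}. a i 0 = k" ..
  let ?l = "pvar 0 - pconst k * pvar n"
  have l: "?l \<in> forms n 1" by (intro forms_diff forms_pconst_mult forms_pvar) auto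
  have ne: "Poly_Mapping.single n (Suc 0) \<noteq> Poly_Mapping.single 0 (Suc 0)"
  proof
    assume "Poly_Mapping.single n (Suc 0) = Poly_Mapping.single 0 (Suc 0)"
    then have "Poly_Mapping.lookup (Poly_Mapping.single n (Suc 0)) 0 = Suc 0" by simp
    then show False using \<open>n \<ge> 1\<close> by (simp add: lookup_single)
  qed
  have "Poly_Mapping.lookup ?l (Poly_Mapping.single 0 1) = 1"
    using \<open>n \<ge> 1\<close>
    by (simp add: lookup_minus lookup_pconst_mult) (simp add: pvar_def lookup_single ne)
  then have "?l \<noteq> 0" by auto
  moreover have "X \<subseteq> proj_zeros n ?l"
    unfolding subset_proj_zeros_iff[OF l]
    using k a_last by (simp add: peval_diff peval_mult)
  ultimately show False using assms(2) l unfolding in_hyperplane_def by blast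
qed

text \<open>The principal ideal consists of the multiples \<open>y * x\<close>, and
  \<open>f + y * x\<close> sends \<open>G\<close> to the sum of \<open>f \<circ>\<^sub>d G\<close>
  and \<open>y \<circ>\<^sub>d (x \<circ>\<^sub>d G)\<close>.\<close>

lemma perp_sum_ideal:
  assumes "ideal J (polyR n)" "x \<in> polys n"
  shows "perp n (J <+>\<^bsub>polyR n\<^esub> Idl\<^bsub>polyR n\<^esub> {x}) = {G \<in> perp n J. x \<circ>\<^sub>d G = 0}"
proof -
  interpret J: ideal J "polyR n" by (rule assms)
  have Idl: "Idl\<^bsub>polyR n\<^esub> {x} = {y * x |y. y \<in> polys n}"
    using cring.cgenideal_eq_genideal[OF cring_polyR, of x n] assms(2)
    by (auto simp: cgenideal_def)
  have sum: "J <+>\<^bsub>polyR n\<^esub> Idl\<^bsub>polyR n\<^esub> {x} = {f + y * x |f y. f \<in> J \<and> y \<in> polys n}"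
    unfolding Idl set_add_def' by auto
  have "f \<in> J <+>\<^bsub>polyR n\<^esub> Idl\<^bsub>polyR n\<^esub> {x}" if "f \<in> J" for f
  proof -
    have "f = f + 0 * x" by simp
    then show ?thesis unfolding sum using that polys_0 by blast
  qed
  moreover have "x \<in> J <+>\<^bsub>polyR n\<^esub> Idl\<^bsub>polyR n\<^esub> {x}"
  proof -
    have "x = 0 + 1 * x" "0 \<in> J" using additive_subgroup.zero_closed[OF J.is_additive_subgroup] by simp_all
    then show ?thesis unfolding sum using polys_1 by blast
  qed
  ultimately show ?thesis
    unfolding perp_def by (auto simp: sum diff_act_add_left diff_act_mult)
qed

section \<open>The two inclusions\<close>

theorem proposition3p12:
  fixes n r s :: nat
    and P :: "nat \<Rightarrow> (nat \<Rightarrow> 'k::{alg_closed_field, field_char_0}) set"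
    and X :: "(nat \<Rightarrow> 'k) set set"
    and a :: "nat \<Rightarrow> nat \<Rightarrow> 'k"
    and L :: "nat \<Rightarrow> 'k mpol"
    and \<alpha> :: "nat \<Rightarrow> 'k"
    and F :: "nat \<Rightarrow> 'k mpol"
  assumes "n \<ge> 1"
    and "X = P ` {1..r}" and "inj_on P {1..r}"
    and "X \<subseteq> proj_space n - proj_zeros n (pvar n)"
    and "\<not> in_hyperplane n X"
    and "has_socle_degree n X s"
    and "\<And>i. i \<in> {1..r} \<Longrightarrow> a i \<in> P i \<and> a i n = 1"
    and "\<And>i. i \<in> {1..r} \<Longrightarrow> L i = linear_form n (a i)"
    and "\<And>i. i \<in> {1..r} \<Longrightarrow> \<alpha> i \<noteq> 0"
    and "\<And>t. t \<ge> 1 \<Longrightarrow> F t = pconst (1 / fact (t + s - 1)) *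
           (\<Sum>i = 1..r. pconst (\<alpha> i) * L i ^ (t + s - 1))"
    and "perp n (vanishing_ideal n X) = generated_submodule n (F ` {1..})"
    and "\<And>t. t > 1 \<Longrightarrow> pvar n \<circ>\<^sub>d F t = F (t - 1)"
    and "pvar n \<circ>\<^sub>d F 1 = 0"
  shows "\<forall>t\<ge>s. act_set (Ann n (F t)) (F (t + 1)) =
           perp n (vanishing_ideal n X <+>\<^bsub>polyR n\<^esub> Idl\<^bsub>polyR n\<^esub> {pvar n})"
proof (intro allI impI)
  fix t assume "t \<ge> s"
  interpret pts: affine_points n r P a
    using assms by unfold_locales auto
  have X: "X = pts.X" by (rule assms)
  have "s > 0" using pts.socle_degree_pos assms(1,5,6) unfolding X .
  \<comment> \<open>The empty set would lie in the hyperplane of \<open>pvar n\<close>.\<close>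
  have "r > 0"
  proof (rule ccontr)
    assume "\<not> r > 0"
    then have "X \<subseteq> proj_zeros n (pvar n)" by (simp add: X)
    moreover have "(pvar n :: 'k mpol) \<noteq> 0"
      using peval_pvar[of n "\<lambda>_. 1 :: 'k"] by (auto simp del: peval_pvar)
    ultimately show False using assms(5) forms_pvar[of n n] unfolding in_hyperplane_def by blast
  qed
  note interpolation = pts.interpolation[OF \<open>r > 0\<close> assms(6)[unfolded X]]
  let ?A = "{1..r}"
  have F: "F k = (\<Sum>i\<in>?A. pconst (\<alpha> i) * dpow n (a i) (k + s - 1))" if "k \<ge> 1" for k
    using assms(8) by (simp add: assms(10)[OF that] dpow_def sum_distrib_left mult.left_commute)
  have F_span: "F ` {1..} \<subseteq> dpow_span n ?A a"
    by (auto simp: F intro!: dpow_span_sum dpow_span_pconst_mult dpow_in_dpow_span)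
  then have perp_span: "perp n (vanishing_ideal n X) \<subseteq> dpow_span n ?A a"
    unfolding assms(11) generated_submodule_def using submodule_dpow_span[of ?A n a] by auto
  have F_perp: "F (t + 1) \<in> perp n (vanishing_ideal n X)"
    unfolding assms(11) generated_submodule_def by auto
  have xF: "pvar n \<circ>\<^sub>d F (t + 1) = F t"
    using assms(12)[of "t + 1"] \<open>s > 0\<close> \<open>t \<ge> s\<close> by simp
  have perp: "perp n (vanishing_ideal n X <+>\<^bsub>polyR n\<^esub> Idl\<^bsub>polyR n\<^esub> {pvar n}) =
      {G \<in> perp n (vanishing_ideal n X). pvar n \<circ>\<^sub>d G = 0}"
    unfolding X by (rule perp_sum_ideal[OF pts.vanishing_ideal_ideal polys_pvar]) simp
  show "act_set (Ann n (F t)) (F (t + 1)) =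
           perp n (vanishing_ideal n X <+>\<^bsub>polyR n\<^esub> Idl\<^bsub>polyR n\<^esub> {pvar n})"
    unfolding perp
  proof (intro equalityI subsetI)
    \<comment> \<open>First inclusion: the operators commute, so whatever kills
      \<open>F (t + 1)\<close> kills \<open>H\<close>, and \<open>pvar n\<close> sends
      \<open>H\<close> to \<open>g \<circ>\<^sub>d F t\<close>, which is 0.\<close>
    fix H assume "H \<in> act_set (Ann n (F t)) (F (t + 1))"
    then obtain g where g: "g \<in> polys n" "g \<circ>\<^sub>d F t = 0" "H = g \<circ>\<^sub>d F (t + 1)"
      by (auto simp: act_set_def Ann_def)
    have "H \<in> dpow_span n ?A a"
      using diff_act_in_dpow_span[OF _ g(1)] perp_span F_perp g(3) by blast
    then have "H \<in> polys n" using dpow_span_subset_polys by blast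
    moreover have "f \<circ>\<^sub>d H = 0" if "f \<in> vanishing_ideal n X" for f
      using F_perp that unfolding g(3) by (subst diff_act_commute) (simp add: perp_def)
    moreover have "pvar n \<circ>\<^sub>d H = 0"
      unfolding g(3) by (subst diff_act_commute) (simp only: xF g(2))
    ultimately show "H \<in> {G \<in> perp n (vanishing_ideal n X). pvar n \<circ>\<^sub>d G = 0}"
      by (simp add: perp_def)
  next
    fix G assume "G \<in> {G \<in> perp n (vanishing_ideal n X). pvar n \<circ>\<^sub>d G = 0}"
    then have "G \<in> dpow_span n ?A a" and xG: "pvar n \<circ>\<^sub>d G = 0"
      using perp_span by auto
    then obtain D c where G: "G = dpow_comb n ?A a D c"
      by (auto simp: dpow_span_def)
    \<comment> \<open>The test form is \<open>g * pvar n\<close> of degree \<open>d\<close>, with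
      \<open>g\<close> of degree \<open>d - 1 \<ge> s\<close> equal to 1 at \<open>a i\<close> and 0
      at the other points. It kills \<open>G\<close> because \<open>pvar n\<close> does, while its
      constant term extracts \<open>c d i\<close>.\<close>
    have c_0: "c d i = 0" if d: "s < d" "d < D" and i: "i \<in> ?A" for d i
    proof -
      have le_diff_d: "s \<le> d - 1" using d by simp
      obtain g where g: "g \<in> forms n (d - 1)" "\<forall>j\<in>?A. peval g (a j) = (if j = i then 1 else 0)"
        using interpolation[OF le_diff_d, of "\<lambda>j. if j = i then 1 else 0"] by blast
      have gx: "g * pvar n \<in> forms n d"
        using forms_mult[OF g(1) forms_pvar[of n n]] d by simp
      have "(\<Sum>j\<in>?A. c d j * peval (g * pvar n) (a j)) = Poly_Mapping.lookup ((g * pvar n) \<circ>\<^sub>d G) 0"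
        unfolding G using lookup_form_act_dpow_comb[OF gx d(2)] by metis
      also have "\<dots> = 0" by (simp add: diff_act_mult xG)
      also have "(\<Sum>j\<in>?A. c d j * peval (g * pvar n) (a j)) = (\<Sum>j\<in>?A. if j = i then c d j else 0)"
        using g(2) pts.a_last by (intro sum.cong) (auto simp: peval_mult)
      finally show ?thesis using i by simp
    qed
    \<comment> \<open>All divided powers in \<open>F (t + 1)\<close> have degree
      \<open>t + s\<close>, so degree \<open>t + s - d\<close> leaves layer \<open>d\<close>; it is
      at least \<open>s\<close> because \<open>d \<le> s \<le> t\<close>. Dividing by
      \<open>\<alpha> i\<close> cancels the coefficient in \<open>F (t + 1)\<close>.\<close>
    have "\<exists>q\<in>forms n (t + s - d). \<forall>i\<in>?A. peval q (a i) = c d i / \<alpha> i" if "d \<le> s" for d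
      using interpolation[of "t + s - d"] \<open>t \<ge> s\<close> that by simp
    then obtain q where q: "\<And>d. d \<le> s \<Longrightarrow> q d \<in> forms n (t + s - d)"
      "\<And>d i. d \<le> s \<Longrightarrow> i \<in> ?A \<Longrightarrow> peval (q d) (a i) = c d i / \<alpha> i"
      by metis
    \<comment> \<open>One summand for each layer that can occur in \<open>G\<close>, so
      \<open>g\<close> is in general not homogeneous.\<close>
    define g where "g = (\<Sum>d\<in>{..<D} \<inter> {..s}. q d)"
    have "q d \<circ>\<^sub>d F (t + 1) = (\<Sum>i\<in>?A. pconst (c d i) * dpow n (a i) d)" if d: "d \<le> s" for d
    proof -
      have "q d \<circ>\<^sub>d F (t + 1) =
        (\<Sum>i\<in>?A. pconst (\<alpha> i) * (pconst (c d i / \<alpha> i) * dpow n (a i) d))"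
        using d by (simp add: F diff_act_sum_right diff_act_pconst_right diff_act_form_dpow[OF q(1)[OF d]] q(2))
      also have "\<dots> = (\<Sum>i\<in>?A. pconst (c d i) * dpow n (a i) d)"
        using assms(9) by (intro sum.cong) (auto simp flip: mult.assoc pconst_mult)
      finally show ?thesis .
    qed
    then have "g \<circ>\<^sub>d F (t + 1) =
        (\<Sum>d\<in>{..<D} \<inter> {..s}. \<Sum>i\<in>?A. pconst (c d i) * dpow n (a i) d)"
      by (simp add: g_def diff_act_sum_left)
    also have "\<dots> = G"
    proof -
      have "(\<Sum>i\<in>?A. pconst (c d i) * dpow n (a i) d) = 0" if "s < d" "d < D" for d
        by (intro sum.neutral) (simp add: c_0[OF that])
      then show ?thesis
        unfolding G dpow_comb_def by (intro sum.mono_neutral_left) (auto simp: not_le)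
    qed
    finally have gF: "g \<circ>\<^sub>d F (t + 1) = G" .
    \<comment> \<open>Writing \<open>F t\<close> as \<open>pvar n \<circ>\<^sub>d F (t + 1)\<close>
      and commuting turns the condition on \<open>G\<close> into membership of \<open>g\<close> in
      the annihilator.\<close>
    have "g \<circ>\<^sub>d F t = pvar n \<circ>\<^sub>d G"
      unfolding xF[symmetric] gF[symmetric] by (rule diff_act_commute)
    moreover have "g \<in> polys n"
      unfolding g_def using forms_imp_polys[OF q(1)] by (intro polys_sum) auto
    ultimately show "G \<in> act_set (Ann n (F t)) (F (t + 1))"
      using gF xG by (auto simp: act_set_def Ann_def)
  qed
qed

end
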